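(* Let $\ket{T} = 2^{-1/2}(\ket{0}+e^{i\pi/4}\ket{1})$ and $\ket{F} = \cos(\beta)\ket{0} + e^{i\pi/4}\sin(\beta)\ket{1}$, where $\beta\in[0,\pi]$ satisfies $\cos(2\beta)=1/\sqrt{3}$. For $\ket{\psi}\in\{\ket{T},\ket{F}\}$ we have $\chi(\psi^{\otimes m}) = O(2^{\alpha m})$ as $m\to\infty$, where $\alpha = \log_2(3)/4 \le 0.3963$.
   Context: An $n$-qubit stabilizer state is a state of the form $C\ket{0^n}$ with $C$ an $n$-qubit Clifford unitary. The stabilizer rank $\chi(\psi)$ of an $n$-qubit state $\ket{\psi}$ is the minimum $k$ such that $\ket{\psi}=\sum_{i=1}^k c_i\ket{\Phi_i}$ with $c_i\in\mathbb{C}$ and $\ket{\Phi_i}$ stabilizer states. $\psi^{\otimes m}$ denotes the $m$-fold tensor power $\ket{\psi}^{\otimes m}$. *)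

theory Defs
  imports Complex_Main "HOL-Library.Landau_Symbols"
begin

text \<open>An n-qubit state is represented by its amplitude function
  v :: nat \<Rightarrow> complex on computational basis indices b < 2^n
  (amplitude 0 outside); qubit j of basis index b is the bit  bit b j.\<close>

type_synonym qstate = "nat \<Rightarrow> complex"

definition basis0 :: qstate where
  "basis0 = (\<lambda>b. if b = 0 then 1 else 0)"

definition hadamard :: "nat \<Rightarrow> qstate \<Rightarrow> qstate" where
  "hadamard j v = (\<lambda>b. (v (unset_bit j b) + (if bit b j then -1 else 1) * v (set_bit j b))
                        / complex_of_real (sqrt 2))"

definition phase_S :: "nat \<Rightarrow> qstate \<Rightarrow> qstate" where
  "phase_S j v = (\<lambda>b. (if bit b j then \<i> else 1) * v b)"

definition cnot :: "nat \<Rightarrow> nat \<Rightarrow> qstate \<Rightarrow> qstate" where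
  "cnot c t v = (\<lambda>b. v (if bit b c then flip_bit t b else b))"

text \<open>Stabilizer states C|0^n> with C a Clifford unitary: the Clifford group is
  generated (up to global phase) by H, S, CNOT; global phases are irrelevant
  for the stabilizer rank since the coefficients are arbitrary complex numbers.\<close>
inductive stab_state :: "nat \<Rightarrow> qstate \<Rightarrow> bool" for n :: nat where
  zero: "stab_state n basis0"
| had: "stab_state n v \<Longrightarrow> j < n \<Longrightarrow> stab_state n (hadamard j v)"
| phs: "stab_state n v \<Longrightarrow> j < n \<Longrightarrow> stab_state n (phase_S j v)"
| cx: "stab_state n v \<Longrightarrow> c < n \<Longrightarrow> t < n \<Longrightarrow> c \<noteq> t \<Longrightarrow> stab_state n (cnot c t v)"

definition stab_rank :: "nat \<Rightarrow> qstate \<Rightarrow> nat" where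
  "stab_rank n v = (LEAST k. \<exists>(c :: nat \<Rightarrow> complex) (\<Phi> :: nat \<Rightarrow> qstate).
      (\<forall>i<k. stab_state n (\<Phi> i)) \<and> v = (\<lambda>b. \<Sum>i<k. c i * \<Phi> i b))"

definition tensor_pow :: "nat \<Rightarrow> complex \<Rightarrow> complex \<Rightarrow> qstate" where
  "tensor_pow m a0 a1 = (\<lambda>b. if b < 2 ^ m then (\<Prod>j<m. if bit b j then a1 else a0) else 0)"

definition T_state_amps :: "complex \<times> complex" where
  "T_state_amps = (1 / complex_of_real (sqrt 2),
                   cis (pi / 4) / complex_of_real (sqrt 2))"

definition F_state_amps :: "real \<Rightarrow> complex \<times> complex" where
  "F_state_amps \<beta> = (complex_of_real (cos \<beta>), cis (pi / 4) * complex_of_real (sin \<beta>))"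

end

theory Submission
  imports Defs
begin

text \<open>For both states four further copies cost only a factor 3 in the number of stabilizer terms, so
  that \<open>\<chi>(\<psi>\<^sup>m) = O(3\<^bsup>m/4\<^esup>)\<close>.

  For F this is because \<open>F\<^sup>4\<close> itself has rank 3. In a suitable Bell basis, up
  to scalars, \<open>F \<otimes> F = e\<^sub>1 + \<omega> e\<^sub>2 + \<omega>\<^sup>2 e\<^sub>3\<close> with \<open>\<omega> = exp(2\<pi>i/3)\<close>, without singlet component, so that
  \<open>F\<^sup>4 = A\<^sub>0 + \<omega> A\<^sub>1 + \<omega>\<^sup>2 A\<^sub>2\<close>, where each \<open>A\<^sub>k\<close> is a sum of three products \<open>e\<^sub>i \<otimes> e\<^sub>j\<close>. Since
  \<open>1 + \<omega> + \<omega>\<^sup>2 = 0\<close>, the product of two singlets may be added to every \<open>A\<^sub>k\<close>; this turns each of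
  them into a stabilizer state.

  For T the linear map taking \<open>T\<^sup>n\<close> to \<open>T\<^bsup>n+4\<^esup>\<close> that sends \<open>|s\<rangle>\<close> on qubit 0 to
  \<open>\<Sum>\<^sub>x t\<^bsup>|x| + s' - s\<^esup> |s', x\<rangle>\<close>, where \<open>t = exp(\<pi>i/4)\<close>, \<open>x\<close> ranges over four bits and \<open>s'\<close> is the
  parity of \<open>s + |x|\<close>, is a combination of three Clifford isometries. On even-weight 6-bit strings
  \<open>(s, s', x)\<close> of weight 0, 2, 4, 6 the powers of \<open>t\<close> are \<open>1, i, -1, -i\<close>, which is a combination of the
  constant, the alternating sign, and a GHZ state repairing the two ends.\<close>

section \<open>Single-bit operations on the low and the high part of an index\<close>

lemma drop_bit_flip_low: "t < n \<Longrightarrow> drop_bit n (flip_bit t b) = drop_bit n (b :: nat)"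
  by (rule bit_eqI) (auto simp: bit_simps)
lemma drop_bit_set_low: "t < n \<Longrightarrow> drop_bit n (set_bit t b) = drop_bit n (b :: nat)"
  by (rule bit_eqI) (auto simp: bit_simps)
lemma drop_bit_unset_low: "t < n \<Longrightarrow> drop_bit n (unset_bit t b) = drop_bit n (b :: nat)"
  by (rule bit_eqI) (auto simp: bit_simps)
lemma take_bit_flip_high: "n \<le> t \<Longrightarrow> take_bit n (flip_bit t b) = take_bit n (b :: nat)"
  by (rule bit_eqI) (auto simp: bit_simps)
lemma take_bit_set_high: "n \<le> t \<Longrightarrow> take_bit n (set_bit t b) = take_bit n (b :: nat)"
  by (rule bit_eqI) (auto simp: bit_simps)
lemma take_bit_unset_high: "n \<le> t \<Longrightarrow> take_bit n (unset_bit t b) = take_bit n (b :: nat)"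
  by (rule bit_eqI) (auto simp: bit_simps)
lemma take_bit_flip_low: "t < n \<Longrightarrow> take_bit n (flip_bit t b) = flip_bit t (take_bit n (b :: nat))"
  by (rule bit_eqI) (auto simp: bit_simps)
lemma drop_bit_flip_high: "drop_bit n (flip_bit (n + t) b) = flip_bit t (drop_bit n (b :: nat))"
  by (rule bit_eqI) (auto simp: bit_simps)
lemma drop_bit_set_high: "drop_bit n (set_bit (n + t) b) = set_bit t (drop_bit n (b :: nat))"
  by (rule bit_eqI) (auto simp: bit_simps)
lemma drop_bit_unset_high: "drop_bit n (unset_bit (n + t) b) = unset_bit t (drop_bit n (b :: nat))"
  by (rule bit_eqI) (auto simp: bit_simps)
lemma flip_bit_flip_bit: "flip_bit t (flip_bit t b) = (b :: nat)"
  by (rule bit_eqI) (auto simp: bit_simps)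

lemma drop_bit_eq_0_iff_less: "drop_bit n b = 0 \<longleftrightarrow> b < 2 ^ n" for b :: nat
  by (auto simp: drop_bit_eq_div div_eq_0_iff)

lemma take_bit_eq_self_drop: "drop_bit n b = 0 \<Longrightarrow> take_bit n b = b" for b :: nat
  by (simp only: drop_bit_eq_0_iff_less take_bit_nat_eq_self)

lemma flip_bit_less_iff: "t < n \<Longrightarrow> flip_bit t b < 2 ^ n \<longleftrightarrow> b < 2 ^ n" for b :: nat
  by (simp add: drop_bit_eq_0_iff_less[symmetric] drop_bit_flip_low)

section \<open>Clifford operations and tensor products on stabilizer states\<close>

lemma stab_support: "stab_state n v \<Longrightarrow> drop_bit n b \<noteq> 0 \<Longrightarrow> v b = 0"
proof (induction arbitrary: b rule: stab_state.induct)
  case zero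
  then show ?case by (cases "b = 0") (auto simp: basis0_def)
next
  case (had v j)
  then show ?case
    by (simp add: hadamard_def drop_bit_set_low drop_bit_unset_low)
next
  case (phs v j)
  then show ?case by (simp add: phase_S_def)
next
  case (cx v c t)
  then show ?case by (simp add: cnot_def drop_bit_flip_low)
qed

text \<open>The circuit preparing \<open>w\<close> is replayed on the qubits from \<open>n\<close>
  on: each of its gates, shifted by \<open>n\<close>, acts on the high part of the index
  alone.\<close>

lemma stab_state_tensor:
  assumes v: "stab_state n v" and w: "stab_state m w"
  shows "stab_state (n + m) (\<lambda>b. v (take_bit n b) * w (drop_bit n b))"
  using w
proof (induction rule: stab_state.induct)
  case zero
  have "stab_state (n + m) v"
    using v by (induction rule: stab_state.induct) (auto intro: stab_state.intros)
  \<comment> \<open>Padding with zero qubits leaves the amplitude function as it is, since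
    \<open>v\<close> already vanishes on all indices with a bit at \<open>n\<close> or
    above.\<close>
  moreover have "(\<lambda>b. v (take_bit n b) * basis0 (drop_bit n b)) = v"
    using stab_support[OF v]
    by (auto simp: fun_eq_iff basis0_def take_bit_eq_self_drop simp del: drop_bit_eq_0_iff_less)
  ultimately show ?case by simp
next
  case (had w j)
  have "(\<lambda>b. v (take_bit n b) * hadamard j w (drop_bit n b)) =
    hadamard (n + j) (\<lambda>b. v (take_bit n b) * w (drop_bit n b))"
    by (auto simp: fun_eq_iff hadamard_def take_bit_set_high take_bit_unset_high
        drop_bit_set_high drop_bit_unset_high bit_drop_bit_eq ring_distribs mult.left_commute)
  then show ?case using had by (auto intro: stab_state.intros)
next
  case (phs w j)
  have "(\<lambda>b. v (take_bit n b) * phase_S j w (drop_bit n b)) =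
    phase_S (n + j) (\<lambda>b. v (take_bit n b) * w (drop_bit n b))"
    by (auto simp: fun_eq_iff phase_S_def bit_drop_bit_eq)
  then show ?case using phs by (auto intro: stab_state.intros)
next
  case (cx w c t)
  have "(\<lambda>b. v (take_bit n b) * cnot c t w (drop_bit n b)) =
    cnot (n + c) (n + t) (\<lambda>b. v (take_bit n b) * w (drop_bit n b))"
    by (auto simp: fun_eq_iff cnot_def take_bit_flip_high drop_bit_flip_high bit_drop_bit_eq)
  then show ?case using cx by (auto intro: stab_state.intros)
qed

text \<open>A fourth root of unity is a power of \<open>\<i>\<close>, so this diagonal gate is a
  power of the phase gate. It supplies Z and the inverse of S.\<close>

lemma stab_phase:
  assumes v: "stab_state n v" and j: "j < n" and w: "w ^ 4 = (1 :: complex)"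
  shows "stab_state n (\<lambda>b. (if bit b j then w else 1) * v b)"
proof -
  have "w \<in> {1, -1, \<i>, -\<i>}"
  proof -
    have "(w - 1) * (w + 1) * ((w - \<i>) * (w + \<i>)) = w ^ 4 - 1"
      by (simp add: algebra_simps eval_nat_numeral)
    then show ?thesis using w by (auto simp: eq_neg_iff_add_eq_0)
  qed
  then have "w = \<i> ^ 0 \<or> w = \<i> ^ 1 \<or> w = \<i> ^ 2 \<or> w = \<i> ^ 3" by (auto simp: power3_eq_cube)
  then obtain k where k: "w = \<i> ^ k" by blast
  have "stab_state n ((phase_S j ^^ k) v)"
    by (induction k) (auto intro: stab_state.intros v j)
  moreover have "(phase_S j ^^ k) v = (\<lambda>b. (if bit b j then \<i> ^ k else 1) * v b)"
    by (induction k) (auto simp: phase_S_def fun_eq_iff)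
  ultimately show ?thesis by (simp only: k)
qed

lemma set_unset_bit_idem [simp]:
  "set_bit j (set_bit j b) = set_bit j (b :: nat)" "unset_bit j (unset_bit j b) = unset_bit j b"
  "set_bit j (unset_bit j b) = set_bit j b" "unset_bit j (set_bit j b) = unset_bit j b"
  by (auto intro!: bit_eqI simp: bit_simps)

text \<open>With every change of a bit expressed as a flip, gate identities reduce to case
  distinctions on the bits involved.\<close>

lemma set_unset_bit_conv_flip:
  "set_bit j b = (if bit b j then b else flip_bit j b)"
  "unset_bit j b = (if bit b j then flip_bit j b else b)" for b :: nat
  by (auto intro!: bit_eqI simp: bit_simps)

lemma complex_sqrt_2_mult_self: "complex_of_real (sqrt 2) * complex_of_real (sqrt 2) = 2"
  by (metis of_real_mult of_real_numeral real_sqrt_mult_self abs_numeral)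

text \<open>X = H Z H.\<close>

lemma stab_X:
  assumes v: "stab_state n v" and j: "j < n"
  shows "stab_state n (\<lambda>b. v (flip_bit j b))"
proof -
  have "stab_state n (hadamard j (\<lambda>b. (if bit b j then -1 else 1) * hadamard j v b))"
    by (intro stab_state.had stab_phase v j) auto
  also have "hadamard j (\<lambda>b. (if bit b j then -1 else 1) * hadamard j v b) = (\<lambda>b. v (flip_bit j b))"
    by (auto simp: fun_eq_iff hadamard_def bit_simps complex_sqrt_2_mult_self set_unset_bit_conv_flip flip_bit_flip_bit
        field_simps)
  finally show ?thesis .
qed

text \<open>CZ is CNOT conjugated by a Hadamard on the target.\<close>

lemma stab_CZ:
  assumes v: "stab_state n v" and c: "c < n" "t < n" "c \<noteq> t"
  shows "stab_state n (\<lambda>b. (if bit b c \<and> bit b t then -1 else 1) * v b)"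
proof -
  have "stab_state n (hadamard t (cnot c t (hadamard t v)))"
    by (intro stab_state.intros v c)
  also have "hadamard t (cnot c t (hadamard t v)) =
    (\<lambda>b. (if bit b c \<and> bit b t then -1 else 1) * v b)"
    using c by (auto simp: fun_eq_iff hadamard_def cnot_def bit_simps complex_sqrt_2_mult_self set_unset_bit_conv_flip flip_bit_flip_bit
        field_simps)
  finally show ?thesis .
qed

text \<open>A fresh qubit \<open>n\<close> in state |0> is appended and turned into |+> by a
  Hadamard.\<close>

lemma stab_plus:
  assumes v: "stab_state n v"
  shows "stab_state (Suc n) (\<lambda>b. (if b < 2 ^ Suc n then v (take_bit n b) else 0) / sqrt 2)"
proof -
  have "stab_state (n + 1) (\<lambda>b. v (take_bit n b) * basis0 (drop_bit n b))"
    by (intro stab_state_tensor v stab_state.zero)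
  then have "stab_state (Suc n) (hadamard n (\<lambda>b. v (take_bit n b) * basis0 (drop_bit n b)))"
    by (intro stab_state.had) auto
  also have "hadamard n (\<lambda>b. v (take_bit n b) * basis0 (drop_bit n b)) =
     (\<lambda>b. (if b < 2 ^ Suc n then v (take_bit n b) else 0) / sqrt 2)"
  proof
    fix b :: nat
    \<comment> \<open>The Hadamard sums over both values of bit \<open>n\<close>. By
      \<open>1\<close> and \<open>2\<close> only the cleared one can meet the support of the fresh
      |0>.\<close>
    have 1: "drop_bit n (unset_bit n b) = 0 \<longleftrightarrow> b < 2 ^ Suc n"
    proof -
      have "b < 2 ^ Suc n \<longleftrightarrow> drop_bit (Suc n) b = 0"
        by (simp only: drop_bit_eq_0_iff_less)
      also have "\<dots> \<longleftrightarrow> drop_bit n (unset_bit n b) = 0"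
      proof -
        have "drop_bit n (unset_bit n b) = 2 * drop_bit (Suc n) b"
          by (rule bit_eqI) (auto simp: bit_simps bit_double_iff gr0_conv_Suc split: if_splits)
        then show ?thesis by simp
      qed
      finally show ?thesis by simp
    qed
    have 2: "drop_bit n (set_bit n b) \<noteq> 0"
      by (auto simp: bit_eq_iff bit_simps intro!: exI[of _ 0])
    show "hadamard n (\<lambda>b. v (take_bit n b) * basis0 (drop_bit n b)) b =
       (if b < 2 ^ Suc n then v (take_bit n b) else 0) / sqrt 2"
      using 1 2 by (simp add: hadamard_def basis0_def take_bit_set_high take_bit_unset_high)
  qed
  finally show ?thesis by simp
qed

lemma add_4_Suc: "n + 4 = Suc (Suc (Suc (Suc n)))"
  by simp

lemma stab_plus4:
  assumes v: "stab_state n v"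
  shows "stab_state (n + 4) (\<lambda>b. (if b < 2 ^ (n + 4) then v (take_bit n b) else 0) / 4)"
proof -
  have s: "z / sqrt 2 / sqrt 2 / sqrt 2 / sqrt 2 = z / 4" for z :: complex
  proof -
    have "z / sqrt 2 / sqrt 2 = z / 2" for z :: complex
      by (simp add: complex_sqrt_2_mult_self)
    from this[of z] this[of "z / 2"] show ?thesis by (simp only: divide_divide_eq_left) simp
  qed
  show ?thesis
    using stab_plus[OF stab_plus[OF stab_plus[OF stab_plus[OF v]]]]
    by (simp add: take_bit_nat_less_exp s if_distrib[of "\<lambda>z. z / complex_of_real (sqrt 2)"]
        if_distrib[of "\<lambda>z. z / 4"] add_4_Suc del: power_Suc divide_divide_eq_left cong: if_cong)
qed

text \<open>A fresh |0> is appended as qubit \<open>n\<close>, and a CNOT from \<open>c\<close>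
  copies bit \<open>c\<close> into it.\<close>

lemma stab_copy:
  assumes v: "stab_state n v" and c: "c < n"
  shows "stab_state (Suc n) (\<lambda>b. if b < 2 ^ Suc n \<and> (bit b n \<longleftrightarrow> bit b c) then v (take_bit n b) else 0)"
proof -
  have "stab_state (n + 1) (\<lambda>b. v (take_bit n b) * basis0 (drop_bit n b))"
    by (intro stab_state_tensor v stab_state.zero)
  then have "stab_state (Suc n) (cnot c n (\<lambda>b. v (take_bit n b) * basis0 (drop_bit n b)))"
    using c by (intro stab_state.cx) auto
  also have "cnot c n (\<lambda>b. v (take_bit n b) * basis0 (drop_bit n b)) =
    (\<lambda>b. if b < 2 ^ Suc n \<and> (bit b n \<longleftrightarrow> bit b c) then v (take_bit n b) else 0)"
  proof
    fix b :: nat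
    \<comment> \<open>The right side says that before the CNOT the fresh qubit, and everything above
      it, was zero.\<close>
    have "b < 2 ^ Suc n \<and> (bit b n \<longleftrightarrow> bit b c) \<longleftrightarrow> drop_bit n (if bit b c then flip_bit n b else b) = 0"
    proof (cases "b < 2 ^ Suc n")
      case True
      then have "drop_bit n b < 2" by (simp add: drop_bit_eq_div less_mult_imp_div_less)
      moreover have "bit b n \<longleftrightarrow> drop_bit n b mod 2 = 1"
        by (simp add: bit_iff_odd_drop_bit odd_iff_mod_2_eq_one)
      moreover have "drop_bit n (flip_bit n b) = flip_bit 0 (drop_bit n b)"
        using drop_bit_flip_high[of n 0] by simp
      ultimately show ?thesis using True
        by (cases "drop_bit n b") (auto simp: less_Suc_eq numeral_2_eq_2 flip_bit_0)
    next
      case False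
      then have "drop_bit (Suc n) b \<noteq> 0" by (simp only: drop_bit_eq_0_iff_less not_False_eq_True)
      moreover have "drop_bit (Suc n) b = drop_bit (Suc n) (flip_bit n b)" by (simp only: drop_bit_flip_low lessI)
      ultimately show ?thesis using False by (auto simp: drop_bit_Suc drop_bit_half)
    qed
    then show "cnot c n (\<lambda>b. v (take_bit n b) * basis0 (drop_bit n b)) b =
      (if b < 2 ^ Suc n \<and> (bit b n \<longleftrightarrow> bit b c) then v (take_bit n b) else 0)"
      by (auto simp: cnot_def basis0_def take_bit_flip_high)
  qed
  finally show ?thesis .
qed

text \<open>All four copies are taken from qubit 0, which produces the GHZ branch used for
  T.\<close>

lemma stab_fanout4:
  assumes v: "stab_state n v" and n: "0 < n"
  shows "stab_state (n + 4) (\<lambda>b. if b < 2 ^ (n + 4) \<and> (\<forall>j<4. bit b (n + j) \<longleftrightarrow> bit b 0)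
    then v (take_bit n b) else 0)"
proof -
  have "(\<forall>j<4. bit b (n + j) \<longleftrightarrow> bit b 0) \<longleftrightarrow>
    (bit b (Suc (Suc (Suc n))) \<longleftrightarrow> bit b 0) \<and> (bit b (Suc (Suc n)) \<longleftrightarrow> bit b 0) \<and>
    (bit b (Suc n) \<longleftrightarrow> bit b 0) \<and> (bit b n \<longleftrightarrow> bit b 0)" for b :: nat
    by (auto simp: eval_nat_numeral All_less_Suc)
  then show ?thesis
    using n
    by (intro back_subst[of "stab_state (n + 4)", OF stab_copy[OF stab_copy[OF stab_copy[OF
      stab_copy[OF v n] zero_less_Suc] zero_less_Suc] zero_less_Suc, folded add_4_Suc]])
      (auto simp: fun_eq_iff add_4_Suc bit_take_bit_iff take_bit_nat_less_exp simp del: power_Suc)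
qed

definition odd_block :: "nat \<Rightarrow> nat \<Rightarrow> bool" where
  "odd_block n b = (bit b n \<noteq> (bit b (n + 1) \<noteq> (bit b (n + 2) \<noteq> bit b (n + 3))))"

text \<open>Four CNOTs with common target 0; \<open>0 < n\<close> keeps the target apart from the
  controls, so their effects simply accumulate.\<close>

lemma stab_add_parity:
  assumes v: "stab_state (n + 4) v" and n: "0 < n"
  shows "stab_state (n + 4) (\<lambda>b. v (if odd_block n b then flip_bit 0 b else b))"
proof -
  have "stab_state (n + 4) (cnot n 0 (cnot (n + 1) 0 (cnot (n + 2) 0 (cnot (n + 3) 0 v))))"
    using n by (intro stab_state.intros v) auto
  also have "\<dots> = (\<lambda>b. v (if odd_block n b then flip_bit 0 b else b))"
    using n by (auto simp: fun_eq_iff cnot_def odd_block_def bit_simps flip_bit_flip_bit)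
  finally show ?thesis .
qed

section \<open>Combinations of k stabilizer states and upper bounds on the rank\<close>

text \<open>Counts terms without asking for minimality, so that upper bounds compose: counts add
  under sums and survive linear maps that preserve stabilizer states.\<close>

inductive spanned :: "nat \<Rightarrow> nat \<Rightarrow> qstate \<Rightarrow> bool" for n :: nat where
  spanned_0: "spanned n 0 (\<lambda>b. 0)"
| spanned_Suc: "spanned n k v \<Longrightarrow> stab_state n \<Phi> \<Longrightarrow> spanned n (Suc k) (\<lambda>b. v b + c * \<Phi> b)"

lemma spanned_add:
  assumes "spanned n k v" "spanned n l w"
  shows "spanned n (k + l) (\<lambda>b. v b + w b)"
  using assms(2)
proof (induction rule: spanned.induct)
  case spanned_0
  then show ?case using assms(1) by simp
next
  case (spanned_Suc l w \<Phi> c)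
  then show ?case using spanned.spanned_Suc[of n "k + l" "\<lambda>b. v b + w b" \<Phi> c] by (simp add: add.assoc)
qed

text \<open>Reindexing by \<open>g\<close> and multiplying by \<open>f\<close> is linear in the
  state, so it can be applied term by term.\<close>

lemma spanned_linear:
  assumes "spanned n k v"
    and "\<And>\<Phi>. stab_state n \<Phi> \<Longrightarrow> stab_state m (\<lambda>b. f b * \<Phi> (g b))"
  shows "spanned m k (\<lambda>b. d * (f b * v (g b)))"
  using assms(1)
proof (induction rule: spanned.induct)
  case spanned_0
  then show ?case by (simp add: spanned.spanned_0)
next
  case (spanned_Suc k v \<Phi> c)
  from spanned.spanned_Suc[OF spanned_Suc(3) assms(2)[OF spanned_Suc(2)], of "d * c"]
  show ?case by (simp add: algebra_simps)
qed

lemma stab_rank_le: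
  assumes "spanned n k v"
  shows "stab_rank n v \<le> k"
proof -
  have "\<exists>(c :: nat \<Rightarrow> complex) (\<Phi> :: nat \<Rightarrow> qstate).
      (\<forall>i<k. stab_state n (\<Phi> i)) \<and> v = (\<lambda>b. \<Sum>i<k. c i * \<Phi> i b)"
    using assms
  proof (induction rule: spanned.induct)
    case spanned_0
    then show ?case by simp
  next
    case (spanned_Suc k v \<Phi> c)
    then obtain d \<Psi> where "\<forall>i<k. stab_state n (\<Psi> i)" "v = (\<lambda>b. \<Sum>i<k. d i * \<Psi> i b)" by blast
    with spanned_Suc(2) show ?case
      by (intro exI[of _ "d(k := c)"] exI[of _ "\<Psi>(k := \<Phi>)"]) (auto simp: less_Suc_eq)
  qed
  then show ?thesis unfolding stab_rank_def by (rule Least_le)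
qed

lemma spanned_tensor:
  assumes "spanned n k v" "stab_state m \<phi>"
  shows "spanned (n + m) k (\<lambda>b. d * (\<phi> (drop_bit n b) * v (take_bit n b)))"
  using assms(1)
proof (rule spanned_linear)
  fix \<Phi> assume "stab_state n \<Phi>"
  from stab_state_tensor[OF this assms(2)]
  show "stab_state (n + m) (\<lambda>b. \<phi> (drop_bit n b) * \<Phi> (take_bit n b))" by (simp add: mult.commute)
qed

lemma tensor_pow_add:
  "tensor_pow (n + m) a0 a1 b = tensor_pow n a0 a1 (take_bit n b) * tensor_pow m a0 a1 (drop_bit n b)"
proof -
  have "b < 2 ^ (n + m) \<longleftrightarrow> drop_bit n b < 2 ^ m"
    by (simp flip: drop_bit_eq_0_iff_less add: add.commute)
  moreover have "(\<Prod>j<n + m. if bit b j then a1 else a0) =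
    (\<Prod>j<n. if bit b j then a1 else a0) * (\<Prod>j<m. if bit b (n + j) then a1 else a0)"
    by (induction m) (auto simp: mult.assoc)
  moreover have "(\<Prod>j<n. if bit b j then a1 else a0) = (\<Prod>j<n. if bit (take_bit n b) j then a1 else a0)"
    by (rule prod.cong) (auto simp: bit_take_bit_iff)
  ultimately show ?thesis
    by (simp add: tensor_pow_def take_bit_nat_less_exp bit_drop_bit_eq)
qed

lemma flip_bit_0_eq_1: "flip_bit 0 (0 :: nat) = 1"
  by (rule bit_eqI) (auto simp: bit_simps)

text \<open>Each qubit is expanded in the computational basis, which doubles the number of terms.
  The bound serves as the start for at most four copies.\<close>

lemma spanned_tensor_pow: "spanned n (2 ^ n) (tensor_pow n a0 a1)"
proof (induction n)
  case 0
  have "tensor_pow 0 a0 a1 = (\<lambda>b. 0 + 1 * basis0 b)"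
    by (auto simp: tensor_pow_def basis0_def)
  then show ?case
    using spanned_Suc[OF spanned_0 stab_state.zero[of 0], of 1] by simp
next
  case (Suc n)
  have 1: "stab_state 1 basis0" "stab_state 1 (\<lambda>b. basis0 (flip_bit 0 b))"
    by (auto intro: stab_state.zero stab_X)
  have "tensor_pow 1 a0 a1 x = a0 * basis0 x + a1 * basis0 (flip_bit 0 x)" for x
  proof -
    have "flip_bit 0 x = 0 \<longleftrightarrow> x = 1"
      by (metis flip_bit_flip_bit flip_bit_0_eq_1)
    then show ?thesis
      by (cases "x < 2") (auto simp: tensor_pow_def basis0_def less_2_cases_iff bit_Suc_0_iff)
  qed
  then have "tensor_pow (Suc n) a0 a1 =
    (\<lambda>b. a0 * (basis0 (drop_bit n b) * tensor_pow n a0 a1 (take_bit n b)) +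
         a1 * (basis0 (flip_bit 0 (drop_bit n b)) * tensor_pow n a0 a1 (take_bit n b)))"
    using tensor_pow_add[of n 1 a0 a1] by (auto simp: fun_eq_iff algebra_simps)
  with spanned_add[OF spanned_tensor[OF Suc 1(1), of a0] spanned_tensor[OF Suc 1(2), of a1]]
  show ?case by (simp add: mult_2)
qed

lemma stab_rank_bigo:
  assumes step: "\<And>n k. 0 < n \<Longrightarrow> spanned n k (tensor_pow n a0 a1) \<Longrightarrow>
      spanned (n + 4) (3 * k) (tensor_pow (n + 4) a0 a1)"
  shows "(\<lambda>m. real (stab_rank m (tensor_pow m a0 a1))) \<in> O(\<lambda>m. 2 powr (log 2 3 / 4 * real m))"
proof (rule bigoI)
  have *: "spanned (n + 4 * q) (3 ^ q * 2 ^ n) (tensor_pow (n + 4 * q) a0 a1)" if "0 < n" for n q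
  proof (induction q)
    case 0
    then show ?case using spanned_tensor_pow by simp
  next
    case (Suc q)
    then show ?case using step[of "n + 4 * q" "3 ^ q * 2 ^ n"] that by (simp add: ac_simps)
  qed
  show "\<forall>\<^sub>F m in at_top. norm (real (stab_rank m (tensor_pow m a0 a1))) \<le>
    16 * norm (2 powr (log 2 3 / 4 * real m))"
    using eventually_gt_at_top[of 0]
  proof eventually_elim
    case (elim m)
    \<comment> \<open>Dividing \<open>m - 1\<close> instead of \<open>m\<close> puts the remainder
      \<open>r\<close> between 1 and 4: \<open>step\<close> requires a nonempty register. The
      constant 16 is the bound 2^4 for the first \<open>r\<close> copies.\<close>
    define q r where "q = (m - 1) div 4" and "r = (m - 1) mod 4 + 1"
    have m: "m = r + 4 * q" and r: "0 < r" "r \<le> 4"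
      using elim by (auto simp: q_def r_def)
    have "stab_rank m (tensor_pow m a0 a1) \<le> 3 ^ q * 2 ^ r"
      unfolding m by (intro stab_rank_le * r)
    also have "\<dots> \<le> 3 ^ q * 2 ^ 4"
      using r by (intro mult_left_mono power_increasing) auto
    finally have "real (stab_rank m (tensor_pow m a0 a1)) \<le> real (3 ^ q * 2 ^ 4)"
      by (simp only: of_nat_le_iff)
    also have "\<dots> = 16 * 3 ^ q" by simp
    also have "(3::real) ^ q = 3 powr real q" by (simp add: powr_realpow)
    also have "\<dots> \<le> 3 powr (real m / 4)" using m by (intro powr_mono) auto
    also have "\<dots> = (2 powr log 2 3) powr (real m / 4)" by simp
    also have "\<dots> = 2 powr (log 2 3 / 4 * real m)" by (simp only: powr_powr) simp
    finally show ?case by simp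
  qed
qed

section \<open>The numerical bound and the four-copy step for T\<close>

text \<open>Only the factor of qubit 0 changes under the flip. Cross-multiplication avoids dividing
  by an amplitude.\<close>

lemma tensor_pow_flip_0:
  assumes "0 < n"
  shows "(if bit b 0 then a1 else a0) * tensor_pow n a0 a1 (flip_bit 0 b) =
    (if bit b 0 then a0 else a1) * tensor_pow n a0 a1 b"
proof -
  obtain m where n: "n = Suc m" using assms by (auto simp: gr0_conv_Suc)
  have "(\<Prod>j<m. if bit (flip_bit 0 b) (Suc j) then a1 else a0) = (\<Prod>j<m. if bit b (Suc j) then a1 else a0)"
    by (rule prod.cong) (auto simp: bit_simps)
  moreover have "flip_bit 0 b < 2 ^ n \<longleftrightarrow> b < 2 ^ n"
    using assms by (rule flip_bit_less_iff)
  ultimately show ?thesis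
    by (simp add: tensor_pow_def n prod.lessThan_Suc_shift bit_simps del: power_Suc prod.lessThan_Suc)
qed

lemma log_2_3_div_4_le: "log 2 3 / 4 \<le> (0.3963 :: real)"
proof -
  \<comment> \<open>The rational bound 149/94 for log 2 3 is 3^94 \<le> 2^149, and 149/376 <
    0.3963.\<close>
  have "94 * log 2 3 = log 2 ((3::real) ^ 94)"
    by (subst log_nat_power) auto
  also have "\<dots> \<le> log 2 (2 ^ 149)"
    by (subst log_le_cancel_iff) auto
  also have "\<dots> = 149 * log 2 2"
    by (subst log_nat_power) auto
  finally show ?thesis by simp
qed

lemma tensor_pow_4:
  "tensor_pow 4 a0 a1 b = (if b < 16 then (if bit b 0 then a1 else a0) * (if bit b 1 then a1 else a0) *
    (if bit b 2 then a1 else a0) * (if bit b 3 then a1 else a0) else 0)"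
  by (simp add: tensor_pow_def eval_nat_numeral)

lemma all_less_4: "(\<forall>j<4. P j) \<longleftrightarrow> P 0 \<and> P 1 \<and> P 2 \<and> P (3 :: nat)"
  by (auto simp: eval_nat_numeral All_less_Suc)

lemma spanned_T_step:
  assumes n: "0 < n" and v: "spanned n k (tensor_pow n a (a * t))"
    and t: "t * t = \<i>" and a: "4 * a ^ 4 = 1"
  shows "spanned (n + 4) (3 * k) (tensor_pow (n + 4) a (a * t))"
proof -
  let ?T = "tensor_pow n a (a * t)"
  \<comment> \<open>The input index belonging to output index \<open>b\<close>: s is recovered from
    s' by adding the parity of x once more.\<close>
  define g where "g b = take_bit n (if odd_block n b then flip_bit 0 b else b)" for b :: nat
  define p where "p b j = (if bit b (n + j) then \<i> else 1 :: complex)" for b j :: nat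
  \<comment> \<open>fU, fV, fG carry the amplitudes of the constant, the alternating and the GHZ isometry.\<close>
  define fU fV fG where
    "fU b = (if b < 2 ^ (n + 4) then (if bit b 0 = odd_block n b then 1 else -\<i>) / 4 else 0)" and
    "fV b = (if b < 2 ^ (n + 4) then (if bit b 0 then \<i> else 1) * (p b 0 * p b 1 * p b 2 * p b 3) / 4 else 0)" and
    "fG b = (if b < 2 ^ (n + 4) \<and> (\<forall>j<4. bit b (n + j) \<longleftrightarrow> bit b 0) then (if bit b 0 then -1 else 1) else 0 :: complex)"
    for b :: nat
  have less: "(if odd_block n b then flip_bit 0 b else b) < 2 ^ (n + 4) \<longleftrightarrow> b < 2 ^ (n + 4)" for b
    using flip_bit_less_iff[of 0 "n + 4" b] by simp
  \<comment> \<open>The phase acts on qubit 0 before the parity is added, so it depends on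
    s.\<close>
  have U: "stab_state (n + 4) (\<lambda>b. fU b * \<Phi> (g b))" if "stab_state n \<Phi>" for \<Phi>
  proof -
    have "stab_state n (\<lambda>b. (if bit b 0 then -\<i> else 1) * \<Phi> b)"
      by (intro stab_phase that n) (simp add: power4_eq_xxxx)
    from stab_add_parity[OF stab_plus4[OF this] n] show ?thesis
      by (rule back_subst[of "stab_state (n + 4)"])
        (use n in \<open>auto simp: fun_eq_iff fU_def g_def less bit_take_bit_iff bit_simps simp del: power_add\<close>)
  qed
  \<comment> \<open>Here the phases follow the addition of the parity and act on s' and x.\<close>
  have V: "stab_state (n + 4) (\<lambda>b. fV b * \<Phi> (g b))" if \<Phi>: "stab_state n \<Phi>" for \<Phi>
  proof -
    have "stab_state (n + 4) (\<lambda>b. (if bit b 0 then \<i> else 1) * ((if bit b (n + 0) then \<i> else 1) *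
      ((if bit b (n + 1) then \<i> else 1) * ((if bit b (n + 2) then \<i> else 1) *
      ((if bit b (n + 3) then \<i> else 1) * ((if (if odd_block n b then flip_bit 0 b else b) < 2 ^ (n + 4)
          then \<Phi> (g b) else 0) / 4))))))"
      unfolding g_def
      by (intro stab_phase stab_add_parity[OF stab_plus4[OF \<Phi>] n]) (use n in \<open>auto simp: power4_eq_xxxx\<close>)
    then show ?thesis
      by (rule back_subst[of "stab_state (n + 4)"])
        (simp add: fun_eq_iff fV_def less p_def mult.assoc del: power_add)
  qed
  \<comment> \<open>The blocks 0000 and 1111 are even, so s' = s and \<open>take_bit n b\<close> is
    the input index.\<close>
  have G: "stab_state (n + 4) (\<lambda>b. fG b * \<Phi> (take_bit n b))" if "stab_state n \<Phi>" for \<Phi>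
  proof -
    have "stab_state n (\<lambda>b. (if bit b 0 then -1 else 1) * \<Phi> b)"
      by (intro stab_phase that n) simp
    from stab_fanout4[OF this n] show ?thesis
      by (rule back_subst[of "stab_state (n + 4)"])
        (use n in \<open>auto simp: fun_eq_iff fG_def bit_take_bit_iff simp del: power_add\<close>)
  qed
  \<comment> \<open>After a factor (-i)^s is split off, constant A and sign B must satisfy A - B = i
    at weight 2 and A + B = -1 at weight 4, so A = (i - 1)/2 and B = -(1 + i)/2. The ends then lack
    2 and -2i. The overall factor a^4 = 1/4 sits inside \<open>fU\<close> and \<open>fV\<close>, and
    turns the GHZ coefficient 2 into 1/2.\<close>
  have "tensor_pow (n + 4) a (a * t) = (\<lambda>b. 2 * (\<i> - 1) / 4 * (fU b * ?T (g b)) +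
      -2 * (1 + \<i>) / 4 * (fV b * ?T (g b)) + 1 / 2 * (fG b * ?T (take_bit n b)))"
  proof
    fix b :: nat
    show "tensor_pow (n + 4) a (a * t) b = 2 * (\<i> - 1) / 4 * (fU b * ?T (g b)) +
      -2 * (1 + \<i>) / 4 * (fV b * ?T (g b)) + 1 / 2 * (fG b * ?T (take_bit n b))"
    proof (cases "b < 2 ^ (n + 4)")
      case True
      have a0: "a \<noteq> 0" using a by auto
      have tt: "t * (t * z) = \<i> * z" for z using t by (simp flip: mult.assoc)
      define Y where "Y = ?T (take_bit n b)"
      have "(if bit b 0 then a * t else a) * ?T (flip_bit 0 (take_bit n b)) = (if bit b 0 then a else a * t) * Y"
        using tensor_pow_flip_0[OF n, of "take_bit n b" "a * t" a] n
        by (simp add: Y_def bit_take_bit_iff)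
      then have "t * (if bit b 0 then t else 1) * ?T (flip_bit 0 (take_bit n b)) = t * (if bit b 0 then 1 else t) * Y"
        using a0 by (auto split: if_splits)
      \<comment> \<open>The inverse of \<open>t\<close> is \<open>- \<i> * t\<close>, because
        \<open>t * t = \<i>\<close>.\<close>
      then have flip: "?T (flip_bit 0 (take_bit n b)) = (if bit b 0 then - \<i> * t * Y else t * Y)"
        using t by (auto simp: mult.assoc tt split: if_splits)
      have g: "?T (g b) = (if odd_block n b then (if bit b 0 then - \<i> * t * Y else t * Y) else Y)"
        using n by (auto simp: g_def take_bit_flip_low flip Y_def)
      have d: "drop_bit n b < 16"
        using True by (simp add: drop_bit_eq_div less_mult_imp_div_less power_add)
      have "4 * tensor_pow (n + 4) a (a * t) b = Y *
        ((if bit b n then t else 1) * (if bit b (n + 1) then t else 1) *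
         (if bit b (n + 2) then t else 1) * (if bit b (n + 3) then t else 1)) * (4 * a ^ 4)"
        by (simp add: tensor_pow_add tensor_pow_4 d bit_drop_bit_eq Y_def power4_eq_xxxx)
      also have "\<dots> = 4 * (2 * (\<i> - 1) / 4 * (fU b * ?T (g b)) +
         -2 * (1 + \<i>) / 4 * (fV b * ?T (g b)) + 1 / 2 * (fG b * ?T (take_bit n b)))"
        using True unfolding a g Y_def[symmetric] fU_def fV_def fG_def p_def odd_block_def
        by (cases "bit b 0"; cases "bit b n"; cases "bit b (Suc n)"; cases "bit b (n + 2)";
            cases "bit b (n + 3)"; simp add: all_less_4 tt t algebra_simps;
            simp add: field_simps)
      finally show ?thesis by (simp only: mult_cancel_left) simp
    next
      case False
      then have "\<not> drop_bit n b < 16" 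
        by (simp add: drop_bit_eq_div power_add div_less_iff_less_mult mult.commute)
      with False show ?thesis
        by (simp add: tensor_pow_add tensor_pow_4 fU_def fV_def fG_def)
    qed
  qed
  moreover have "spanned (n + 4) (k + k + k) (\<lambda>b. 2 * (\<i> - 1) / 4 * (fU b * ?T (g b)) +
      -2 * (1 + \<i>) / 4 * (fV b * ?T (g b)) + 1 / 2 * (fG b * ?T (take_bit n b)))"
    by (intro spanned_add spanned_linear[OF v] U V G)
  ultimately show ?thesis by (simp add: numeral_3_eq_3 add.assoc)
qed

section \<open>The four-copy step for F\<close>

text \<open>With w = \<open>\<plusminus>1\<close> and \<open>w = \<plusminus>i\<close> these are, up to scalars, the states \<open>A\<^sub>0\<close> and \<open>A\<^sub>1\<close> completed by a product of two
  singlets, and \<open>stab_F_bell\<close> below is the completed \<open>A\<^sub>2\<close>.\<close>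
lemma stab_F_graph:
  assumes w: "w ^ 4 = (1 :: complex)"
  shows "stab_state 4 (\<lambda>b. if b < 16 then (if bit b 0 then w else 1) * (if bit b 1 then w else 1) *
    (if bit b 2 then w else 1) * (if bit b 3 then w else 1) *
    (if bit b 1 \<and> bit b 2 then -1 else 1) * (if bit b 0 \<and> bit b 3 then -1 else 1) / 4 else 0)"
    (is "stab_state 4 ?f")
proof -
  have "stab_state (0 + 4) (\<lambda>b. (if bit b 0 then w else 1) * ((if bit b 1 then w else 1) *
    ((if bit b 2 then w else 1) * ((if bit b 3 then w else 1) *
    ((if bit b 1 \<and> bit b 2 then -1 else 1) * ((if bit b 0 \<and> bit b 3 then -1 else 1) *
    ((if b < 2 ^ (0 + 4) then basis0 (take_bit 0 b) else 0) / 4)))))))"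
    by (intro stab_phase stab_CZ stab_plus4 stab_state.zero w) auto
  also have "\<dots> = ?f"
    by (auto simp: fun_eq_iff basis0_def)
  finally show ?thesis by simp
qed

lemma stab_F_bell:
  "stab_state 4 (\<lambda>b. if b < 16 \<and> (bit b 3 \<longleftrightarrow> bit b 0) \<and> (bit b 2 \<longleftrightarrow> bit b 1)
     then (if bit b 0 then \<i> else 1) * (if bit b 1 then \<i> else 1) / 2 else 0)"
    (is "stab_state 4 ?f")
proof -
  have less: "take_bit (Suc (Suc 0)) b < 4" "take_bit (Suc (Suc (Suc 0))) b < 8" for b :: nat
    using take_bit_nat_less_exp[of "Suc (Suc 0)" b] take_bit_nat_less_exp[of "Suc (Suc (Suc 0))" b]
    by simp_all
  have bits: "bit b 2 \<longleftrightarrow> bit b (Suc (Suc 0))" "bit b 3 \<longleftrightarrow> bit b (Suc (Suc (Suc 0)))" for b :: nat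
    by (simp_all only: numeral_2_eq_2 numeral_3_eq_3)
  have "stab_state (Suc (Suc 0)) (\<lambda>b. (if b < 4 then 1 else 0) / 2)"
    by (rule back_subst[of "stab_state (Suc (Suc 0))", OF stab_plus[OF stab_plus[OF stab_state.zero]]])
       (auto simp: fun_eq_iff basis0_def take_bit_nat_less_exp complex_sqrt_2_mult_self)
  then have "stab_state (Suc (Suc 0)) (\<lambda>b. (if bit b 0 then \<i> else 1) * ((if bit b 1 then \<i> else 1) *
      ((if b < 4 then 1 else 0) / 2)))"
    by (intro stab_phase) (auto simp: power4_eq_xxxx)
  from stab_copy[OF stab_copy[OF this lessI] zero_less_Suc]
  have "stab_state (0 + 4) ?f"
    unfolding add_4_Suc
    by (elim back_subst[of "stab_state (Suc (Suc (Suc (Suc 0))))"])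
      (auto simp: fun_eq_iff bit_take_bit_iff bits less)
  then show ?thesis by simp
qed

text \<open>Here s is the sign of \<open>cos \<beta>\<close>: the hypothesis on \<open>\<beta>\<close> admits two angles, one in each half
  of \<open>[0, \<pi>]\<close>.\<close>
lemma spanned_F_step:
  assumes v: "spanned n k (tensor_pow n a b)" and s: "s = 1 \<or> s = (-1 :: complex)"
    and \<omega>: "1 + \<omega> + \<omega> * \<omega> = 0"
    and amp: "a ^ 4 = K * (1 - \<omega> + 2 * \<i> * \<omega> ^ 2)" "a ^ 3 * b = s * K * (1 - \<i> * \<omega>)"
      "a ^ 2 * b ^ 2 = - K * \<omega> ^ 2" "a * b ^ 3 = - s * K * (1 + \<i> * \<omega>)"
      "b ^ 4 = K * (1 - \<omega> - 2 * \<i> * \<omega> ^ 2)"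
  shows "spanned (n + 4) (3 * k) (tensor_pow (n + 4) a b)"
proof -
  define \<phi> where "\<phi> w x = (if x < 16 then (if bit x 0 then w else 1) * (if bit x 1 then w else 1) *
    (if bit x 2 then w else 1) * (if bit x 3 then w else 1) *
    (if bit x 1 \<and> bit x 2 then -1 else 1) * (if bit x 0 \<and> bit x 3 then -1 else 1) / 4 else 0)"
    for w :: complex and x :: nat
  define \<psi> where "\<psi> x = (if x < 16 \<and> (bit x 3 \<longleftrightarrow> bit x 0) \<and> (bit x 2 \<longleftrightarrow> bit x 1)
     then (if bit x 0 then \<i> else 1) * (if bit x 1 then \<i> else 1) / 2 else 0)" for x :: nat
  have \<phi>: "stab_state 4 (\<phi> w)" if "w ^ 4 = 1" for w
    using stab_F_graph[OF that] by (simp add: \<phi>_def[abs_def])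
  have \<psi>: "stab_state 4 \<psi>"
    using stab_F_bell by (simp add: \<psi>_def[abs_def])
  \<comment> \<open>Checked on all sixteen basis states; the left side depends on the Hamming weight
    of \<open>x\<close> alone, and \<open>amp\<close> lists its five values.\<close>
  have t4: "tensor_pow 4 a b x = 4 * K * \<phi> s x + -4 * K * \<omega> * \<phi> (\<i> * s) x + 4 * \<i> * K * \<omega> ^ 2 * \<psi> x" for x
  proof -
    have ss: "s * s = 1" "s * (s * z) = z" for z using s by auto
    have w2: "\<omega> * \<omega> = - 1 - \<omega>" using \<omega> by (simp add: algebra_simps eq_neg_iff_add_eq_0)
    \<comment> \<open>The same reduction of the degree in \<open>\<omega>\<close>, in the form that
      matches right-nested products.\<close>
    have w3: "\<omega> * (\<omega> * z) = - z - \<omega> * z" for z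
      by (simp add: w2 ring_distribs flip: mult.assoc)
    show ?thesis
      using amp
      by (cases "bit x 0"; cases "bit x 1"; cases "bit x 2"; cases "bit x 3")
        (simp_all add: tensor_pow_4 \<phi>_def \<psi>_def power4_eq_xxxx power3_eq_cube
          power2_eq_square ss w2 w3 algebra_simps)
  qed
  have "tensor_pow (n + 4) a b = (\<lambda>x. 4 * K * (\<phi> s (drop_bit n x) * tensor_pow n a b (take_bit n x)) +
     (-4 * K * \<omega>) * (\<phi> (\<i> * s) (drop_bit n x) * tensor_pow n a b (take_bit n x)) +
     4 * \<i> * K * \<omega> ^ 2 * (\<psi> (drop_bit n x) * tensor_pow n a b (take_bit n x)))"
    by (simp add: fun_eq_iff tensor_pow_add t4 algebra_simps)
  moreover have "spanned (n + 4) (k + k + k) \<dots>"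
    by (intro spanned_add spanned_tensor v \<phi> \<psi>) (use s in \<open>auto simp: power4_eq_xxxx\<close>)
  ultimately show ?thesis by (simp add: numeral_3_eq_3 add.assoc)
qed

lemma stab_rank_F_bigo:
  fixes \<beta> :: real
  assumes "0 \<le> \<beta>" and "\<beta> \<le> pi" and cos2: "cos (2 * \<beta>) = 1 / sqrt 3"
  shows "(\<lambda>m. real (stab_rank m (tensor_pow m (fst (F_state_amps \<beta>)) (snd (F_state_amps \<beta>)))))
    \<in> O(\<lambda>m. 2 powr (log 2 3 / 4 * real m))"
proof (rule stab_rank_bigo)
  fix n k
  define a b where "a = fst (F_state_amps \<beta>)" and "b = snd (F_state_amps \<beta>)"
  define \<sigma> :: real where "\<sigma> = sgn (cos \<beta>)"
  define q :: real where "q = sqrt 3"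
  have q: "q * q = 3" "q > 0" by (auto simp: q_def)
  have s0: "sin \<beta> \<ge> 0" using assms by (intro sin_ge_zero) auto
  have c2: "(cos \<beta>)\<^sup>2 = (3 + q) / 6" 
  proof -
    have "3 * cos (2 * \<beta>) = q * (q * cos (2 * \<beta>))" using q by (simp flip: mult.assoc)
    also have "q * cos (2 * \<beta>) = 1" using cos2 q by (simp add: q_def)
    finally have "cos (2 * \<beta>) = q / 3" by simp
    then show ?thesis using cos_double_cos[of \<beta>] by simp
  qed
  have s2: "(sin \<beta>)\<^sup>2 = (3 - q) / 6"
    unfolding sin_squared_eq c2 by (simp add: field_simps)
  have cs: "cos \<beta> * sin \<beta> = \<sigma> / sqrt 6"
  proof -
    have "(\<bar>cos \<beta>\<bar> * sin \<beta>)\<^sup>2 = 1 / 6"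
      using q by (simp add: power_mult_distrib c2 s2 field_simps)
    then have "\<bar>cos \<beta>\<bar> * sin \<beta> = sqrt (1 / 6)"
      using s0 by (metis abs_ge_zero mult_nonneg_nonneg real_sqrt_unique)
    then show ?thesis by (auto simp: \<sigma>_def real_sqrt_divide sgn_if abs_if split: if_splits)
  qed
  have "cos \<beta> \<noteq> 0" using c2 q by auto
  then have \<sigma>: "\<sigma> = 1 \<or> \<sigma> = -1" by (auto simp: \<sigma>_def sgn_if)
  define e where "e = cis (pi / 4)"
  have e2: "e * e = \<i>" by (simp add: e_def cis_mult)
  have e: "e = (1 + \<i>) / sqrt 2"
    by (simp add: e_def complex_eq_iff cos_45 sin_45 real_div_sqrt field_simps)
  \<comment> \<open>The sqrt 2 in \<open>e\<close> merges with the sqrt 6 in \<open>cs\<close> into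
    a multiple of sqrt 3. The products below are grouped so that only this term, the squares and
    \<open>e * e\<close> occur, and \<open>q * q = 3\<close> settles the rest.\<close>
  have cse: "cos \<beta> * sin \<beta> * e = of_real (\<sigma> * q / 6) * (1 + \<i>)"
  proof -
    have "cos \<beta> * sin \<beta> * e = of_real (cos \<beta> * sin \<beta> / sqrt 2) * (1 + \<i>)"
      by (simp add: e)
    also have "sqrt 6 * sqrt 2 = 2 * q"
      by (simp add: q_def flip: real_sqrt_mult) (use real_sqrt_mult[of 4 3] in simp)
    then have "cos \<beta> * sin \<beta> / sqrt 2 = \<sigma> * q / 6"
      using q by (simp add: cs field_simps)
    finally show ?thesis .
  qed
  \<comment> \<open>\<open>\<omega>\<close> is the cube root of unity exp(2\<pi>i/3). The value of
    \<open>K\<close> is forced by a^2 b^2 = i/6 = -K \<omega>^2.\<close>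
  define \<omega> where "\<omega> = Complex (- 1 / 2) (q / 2)"
  define K where "K = - \<i> * \<omega> / 6"
  show "spanned (n + 4) (3 * k) (tensor_pow (n + 4) a b)" if "spanned n k (tensor_pow n a b)"
    using that
  proof (rule spanned_F_step[where s = "of_real \<sigma>" and K = K and \<omega> = \<omega>])
    show "complex_of_real \<sigma> = 1 \<or> complex_of_real \<sigma> = - 1" using \<sigma> by auto
    show "1 + \<omega> + \<omega> * \<omega> = 0" using q by (simp add: \<omega>_def complex_eq_iff field_simps)
    have "a ^ 4 = of_real ((cos \<beta>)\<^sup>2 * (cos \<beta>)\<^sup>2)" by (simp add: a_def F_state_amps_def eval_nat_numeral)
    also have "\<dots> = K * (1 - \<omega> + 2 * \<i> * \<omega> ^ 2)"
      unfolding c2 K_def \<omega>_def using q by (simp add: complex_eq_iff power2_eq_square field_simps)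
    finally show "a ^ 4 = K * (1 - \<omega> + 2 * \<i> * \<omega> ^ 2)" .
    have "a ^ 3 * b = of_real ((cos \<beta>)\<^sup>2) * (cos \<beta> * sin \<beta> * e)"
      by (simp add: a_def b_def F_state_amps_def e_def eval_nat_numeral)
    also have "\<dots> = of_real \<sigma> * K * (1 - \<i> * \<omega>)"
      unfolding c2 cse K_def \<omega>_def using q by (simp add: complex_eq_iff power2_eq_square field_simps)
    finally show "a ^ 3 * b = of_real \<sigma> * K * (1 - \<i> * \<omega>)" .
    have "a ^ 2 * b ^ 2 = of_real ((cos \<beta>)\<^sup>2 * (sin \<beta>)\<^sup>2) * (e * e)"
      by (simp add: a_def b_def F_state_amps_def e_def eval_nat_numeral)
    also have "\<dots> = - K * \<omega> ^ 2"
      unfolding c2 s2 e2 K_def \<omega>_def using q by (simp add: complex_eq_iff power2_eq_square field_simps)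
    finally show "a ^ 2 * b ^ 2 = - K * \<omega> ^ 2" .
    have "a * b ^ 3 = of_real ((sin \<beta>)\<^sup>2) * (cos \<beta> * sin \<beta> * e) * (e * e)"
      by (simp add: a_def b_def F_state_amps_def e_def eval_nat_numeral)
    also have "\<dots> = - of_real \<sigma> * K * (1 + \<i> * \<omega>)"
      unfolding s2 e2 cse K_def \<omega>_def using q by (simp add: complex_eq_iff power2_eq_square field_simps)
    finally show "a * b ^ 3 = - of_real \<sigma> * K * (1 + \<i> * \<omega>)" .
    have "b ^ 4 = of_real ((sin \<beta>)\<^sup>2 * (sin \<beta>)\<^sup>2) * (e * e) * (e * e)"
      by (simp add: b_def F_state_amps_def e_def eval_nat_numeral)
    also have "\<dots> = K * (1 - \<omega> - 2 * \<i> * \<omega> ^ 2)"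
      unfolding s2 e2 K_def \<omega>_def using q by (simp add: complex_eq_iff power2_eq_square field_simps)
    finally show "b ^ 4 = K * (1 - \<omega> - 2 * \<i> * \<omega> ^ 2)" .
  qed
qed

section \<open>The T state and the combined bound\<close>

lemma stab_rank_T_bigo:
  "(\<lambda>m. real (stab_rank m (tensor_pow m (fst T_state_amps) (snd T_state_amps))))
    \<in> O(\<lambda>m. 2 powr (log 2 3 / 4 * real m))"
proof (rule stab_rank_bigo)
  fix n k :: nat
  assume n: "0 < n" and v: "spanned n k (tensor_pow n (fst T_state_amps) (snd T_state_amps))"
  define a where "a = fst T_state_amps"
  define t where "t = cis (pi / 4)"
  have "snd T_state_amps = a * t" by (simp add: a_def t_def T_state_amps_def)
  moreover have "t * t = \<i>" by (simp add: t_def cis_mult)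
  moreover have "4 * a ^ 4 = 1"
    by (simp add: a_def T_state_amps_def power4_eq_xxxx complex_sqrt_2_mult_self mult.assoc field_simps)
  ultimately show "spanned (n + 4) (3 * k) (tensor_pow (n + 4) (fst T_state_amps) (snd T_state_amps))"
    using spanned_T_step[OF n, of k a t] v by (simp flip: a_def)
qed

theorem theorem1:
  fixes \<beta> :: real
  assumes "0 \<le> \<beta>" and "\<beta> \<le> pi" and "cos (2 * \<beta>) = 1 / sqrt 3"
  shows "(\<forall>amps \<in> {T_state_amps, F_state_amps \<beta>}.
           (\<lambda>m. real (stab_rank m (tensor_pow m (fst amps) (snd amps))))
             \<in> O(\<lambda>m. 2 powr (log 2 3 / 4 * real m)))
         \<and> log 2 3 / 4 \<le> (0.3963 :: real)"
  using stab_rank_T_bigo stab_rank_F_bigo[OF assms] log_2_3_div_4_le by blast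

end
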